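(* Let $\Omega\subset\mathbb{C}^n$ be a bounded convex domain with $\mathcal{C}^1$-smooth boundary. Suppose that there exist a constant $r>0$, a function $\omega:[0,2r)\to[0,\infty)$ satisfying a Dini condition, and a defining function $\rho$ for $\Omega$ such that for each $\xi\in\partial\Omega$ the directional derivative $D_{i\eta^{\xi}}\rho$ has modulus of continuity $\omega$ on the ball $B^{(n)}(\xi,r)$. Let $z_0\in\Omega$. Then there exists a constant $C>0$ such that $$\mathsf{k}_{\Omega}(z_0,z)\le C+\frac12\log\left(\frac{1}{\mathrm{dist}(z,\Omega^{\mathsf{c}})}\right)\quad\text{for all } z\in\Omega.$$
   Context: Notation: $\mathbb{C}^n$ is identified with $\mathbb{R}^{2n}$ in the usual way; $B^{(n)}(a,r)$ is the open Euclidean ball in $\mathbb{C}^n$ with centre $a$ and radius $r$; $\mathsf{k}_\Omega$ is the Kobayashi distance on $\Omega$, normalized so that on the unit disk $\mathsf{k}_{\mathbb{D}}(0,\zeta)=\frac12\log\frac{1+|\zeta|}{1-|\zeta|}$; $\Omega^{\mathsf{c}}=\mathbb{C}^n\setminus\Omega$ and $\mathrm{dist}$ is Euclidean distance. Boundary data: a defining function for a bounded domain $\Omega$ with $\mathcal{C}^1$ boundary is a real-valued $\mathcal{C}^1$ function $\rho$ on a neighbourhood $U$ of $\partial\Omega$ with $\Omega\cap U=\{\rho<0\}$, $\partial\Omega=\{\rho=0\}$, and $D\rho\neq 0$ on $\partial\Omega$; $U$ is understood to contain the balls $B^{(n)}(\xi,r)$, $\xi\in\partial\Omega$, occurring in the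 statement. For $\xi\in\partial\Omega$, $\eta^\xi$ is the unit inward-pointing normal to $\partial\Omega$ at $\xi$, regarded as a vector in $\mathbb{C}^n$, and $i\eta^\xi$ is its product with $i$. For a unit vector $v$, $D_v\rho$ is the real directional derivative of $\rho$ in the direction $v$. Modulus of continuity: a function $f$ on a ball $B^{(n)}(\xi,r)$ has modulus of continuity $\omega:[0,2r)\to[0,\infty)$ if $\omega$ is non-decreasing, $\omega(0)=0$, $\omega$ is continuous at $0$, and $|f(x)-f(y)|\le\omega(\|x-y\|)$ for all $x,y$ in the ball. Dini condition: a Lebesgue-measurable $g:[0,\epsilon_0)\to[0,\infty)$, $\epsilon_0>0$, satisfies a Dini condition if $\int_0^{\epsilon_0}\frac{g(t)}{t}\,dt<\infty$. *)

theory Defs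
  imports "HOL-Analysis.Analysis"
begin

text \<open>The space \<open>\<complex>\<^sup>n\<close> is \<open>complex ^ 'n\<close>, whose library norm and real inner product are those of
  \<open>\<real>\<^sup>2\<^sup>n\<close>; multiplication of a vector by \<open>\<i>\<close> is \<open>\<i> *s v\<close>.\<close>

subsection \<open>The Kobayashi distance\<close>

definition poincare_dist :: "complex \<Rightarrow> complex \<Rightarrow> real" where
  "poincare_dist a b =
     (let m = cmod ((a - b) / (1 - cnj a * b)) in 1 / 2 * ln ((1 + m) / (1 - m)))"

definition holomorphic_disc :: "(complex ^ 'n) set \<Rightarrow> (complex \<Rightarrow> complex ^ 'n) \<Rightarrow> bool" where
  "holomorphic_disc \<Omega> f \<longleftrightarrow>
     (\<forall>i. (\<lambda>\<zeta>. f \<zeta> $ i) holomorphic_on ball 0 1) \<and> f ` ball 0 1 \<subseteq> \<Omega>"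

text \<open>The infimum of the lengths of chains of holomorphic discs from \<open>z\<close> to \<open>w\<close>. The set of lengths
  is bounded below by \<open>0\<close>, and it is nonempty when \<open>z\<close> and \<open>w\<close> lie in a domain \<open>\<Omega>\<close>.\<close>

definition kobayashi_dist :: "(complex ^ 'n) set \<Rightarrow> complex ^ 'n \<Rightarrow> complex ^ 'n \<Rightarrow> real" where
  "kobayashi_dist \<Omega> z w = Inf {\<Sum>j<m. poincare_dist (a j) (b j) | m p f a b.
     m \<ge> (1::nat) \<and> p 0 = z \<and> p m = w \<and>
     (\<forall>j<m. holomorphic_disc \<Omega> (f j) \<and> a j \<in> ball 0 1 \<and> b j \<in> ball 0 1 \<and>
            f j (a j) = p j \<and> f j (b j) = p (Suc j))}"

subsection \<open>Boundary regularity\<close>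

definition C1_on :: "'a::euclidean_space set \<Rightarrow> ('a \<Rightarrow> real) \<Rightarrow> bool" where
  "C1_on U f \<longleftrightarrow> (\<exists>f' :: 'a \<Rightarrow> 'a \<Rightarrow>\<^sub>L real.
     (\<forall>x\<in>U. (f has_derivative blinfun_apply (f' x)) (at x)) \<and> continuous_on U f')"

definition C1_boundary :: "'a::euclidean_space set \<Rightarrow> bool" where
  "C1_boundary \<Omega> \<longleftrightarrow> (\<forall>\<xi>\<in>frontier \<Omega>. \<exists>V \<sigma>. open V \<and> \<xi> \<in> V \<and> C1_on V \<sigma> \<and>
     \<Omega> \<inter> V = {x \<in> V. \<sigma> x < 0} \<and> frontier \<Omega> \<inter> V = {x \<in> V. \<sigma> x = 0} \<and>
     (\<forall>x \<in> frontier \<Omega> \<inter> V. frechet_derivative \<sigma> (at x) \<noteq> (\<lambda>v. 0)))"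

definition defining_function ::
  "'a::euclidean_space set \<Rightarrow> 'a set \<Rightarrow> ('a \<Rightarrow> real) \<Rightarrow> bool" where
  "defining_function \<Omega> U \<rho> \<longleftrightarrow> open U \<and> frontier \<Omega> \<subseteq> U \<and> C1_on U \<rho> \<and>
     \<Omega> \<inter> U = {x \<in> U. \<rho> x < 0} \<and> frontier \<Omega> = {x \<in> U. \<rho> x = 0} \<and>
     (\<forall>x \<in> frontier \<Omega>. frechet_derivative \<rho> (at x) \<noteq> (\<lambda>v. 0))"

definition directional_derivative ::
  "'a::real_normed_vector \<Rightarrow> ('a \<Rightarrow> real) \<Rightarrow> 'a \<Rightarrow> real" where
  "directional_derivative v f x = deriv (\<lambda>t. f (x + t *\<^sub>R v)) 0"

text \<open>Tangent vectors are the velocities of curves in \<open>S\<close>. For a \<open>C\<^sup>1\<close> hypersurface it makes no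
  difference whether the curves are \<open>C\<^sup>1\<close> or only differentiable at \<open>0\<close>.\<close>

definition tangent_vectors :: "'a::real_normed_vector set \<Rightarrow> 'a \<Rightarrow> 'a set" where
  "tangent_vectors S \<xi> = {v. \<exists>\<gamma> :: real \<Rightarrow> 'a. \<gamma> 0 = \<xi> \<and>
     (\<exists>\<epsilon>>0. \<forall>t. \<bar>t\<bar> < \<epsilon> \<longrightarrow> \<gamma> t \<in> S) \<and> (\<gamma> has_vector_derivative v) (at 0)}"

text \<open>For \<open>\<Omega>\<close> with \<open>C\<^sup>1\<close> boundary and \<open>\<xi> \<in> frontier \<Omega>\<close>, exactly one vector satisfies this predicate.\<close>

definition inward_unit_normal :: "'a::euclidean_space set \<Rightarrow> 'a \<Rightarrow> 'a \<Rightarrow> bool" where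
  "inward_unit_normal \<Omega> \<xi> \<eta> \<longleftrightarrow> norm \<eta> = 1 \<and>
     (\<forall>v \<in> tangent_vectors (frontier \<Omega>) \<xi>. \<eta> \<bullet> v = 0) \<and>
     (\<exists>\<epsilon>>0. \<forall>t. 0 < t \<and> t < \<epsilon> \<longrightarrow> \<xi> + t *\<^sub>R \<eta> \<in> \<Omega>)"

subsection \<open>Moduli of continuity and the Dini condition\<close>

text \<open>A function with domain \<open>[0, c)\<close> is given by a function on the reals of which only the values
  on \<open>{0..<c}\<close> matter.\<close>

definition has_modulus_of_continuity_on_ball ::
  "'a::euclidean_space \<Rightarrow> real \<Rightarrow> ('a \<Rightarrow> real) \<Rightarrow> (real \<Rightarrow> real) \<Rightarrow> bool" where
  "has_modulus_of_continuity_on_ball \<xi> r f \<omega> \<longleftrightarrow>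
     (\<forall>t\<in>{0..<2*r}. 0 \<le> \<omega> t) \<and> mono_on {0..<2*r} \<omega> \<and> \<omega> 0 = 0 \<and>
     continuous (at 0 within {0..<2*r}) \<omega> \<and>
     (\<forall>x\<in>ball \<xi> r. \<forall>y\<in>ball \<xi> r. \<bar>f x - f y\<bar> \<le> \<omega> (norm (x - y)))"

definition dini_condition :: "real \<Rightarrow> (real \<Rightarrow> real) \<Rightarrow> bool" where
  "dini_condition \<epsilon> g \<longleftrightarrow> \<epsilon> > 0 \<and> (\<forall>t\<in>{0..<\<epsilon>}. 0 \<le> g t) \<and>
     set_borel_measurable lebesgue {0..<\<epsilon>} g \<and>
     (\<integral>\<^sup>+ t\<in>{0..<\<epsilon>}. ennreal (g t / t) \<partial>lebesgue) < \<infinity>"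

end

theory Submission
  imports Defs "HOL-Complex_Analysis.Complex_Analysis"
begin

text \<open>
  Let \<open>\<xi>\<close> be a boundary point nearest to \<open>z\<close>, and \<open>\<eta>\<close> the normal there. The modulus of continuity of
  \<open>D\<^bsub>i\<eta>\<^esub> \<rho>\<close>, which vanishes at \<open>\<xi>\<close>, shows that \<open>\<xi> + w\<eta>\<close> lies in \<open>\<Omega>\<close> as soon as \<open>w\<close> is small and
  \<open>Re w > A \<bar>Im w\<bar> \<omega> \<bar>Im w\<bar>\<close>, uniformly in \<open>\<xi>\<close>. The Dini condition makes it possible to write
  down a holomorphic map \<open>h w = w (1 + \<Sum>\<^sub>k c\<^sub>k s\<^sub>k / (w + s\<^sub>k))\<close> of a small half-disc at \<open>0\<close> into this
  region, comparable to \<open>w\<close> and real on the real axis: each summand has nonnegative real part after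
  multiplication by \<open>w\<close>, and the one with \<open>s\<^sub>k\<close> of the size of \<open>\<bar>w\<bar>\<close> contributes the required
  multiple of \<open>\<bar>w\<bar> \<omega> (2 \<bar>w\<bar>)\<close>. The disc \<open>\<zeta> \<mapsto> \<xi> + h (\<tau> (1 - \<zeta>)) \<eta>\<close> then joins \<open>z\<close> to a
  point at a fixed depth at the cost \<open>1/2 log (1 / dist z) + O(1)\<close>, and points at a fixed depth are joined to
  \<open>z\<^sub>0\<close> by boundedly many discs because \<open>\<Omega>\<close> is bounded and convex.
\<close>

section \<open>Upper bounds for the Kobayashi distance by chains of discs\<close>

lemma poincare_dist_nonneg:
  assumes "a \<in> ball 0 1" "b \<in> ball 0 1"
  shows "0 \<le> poincare_dist a b"
proof -
  define m where "m = cmod ((a - b) / (1 - cnj a * b))"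
  have "cmod (Moebius_function 0 a b) < 1"
    using assms by (intro Moebius_function_norm_lt_1) auto
  then have "0 \<le> m" "m < 1"
    by (auto simp: m_def Moebius_function_def norm_divide norm_minus_commute)
  then show ?thesis
    unfolding poincare_dist_def Let_def m_def[symmetric] by (simp add: divide_simps)
qed

lemma poincare_dist_0_of_real:
  assumes "0 \<le> x" "x < 1"
  shows "poincare_dist 0 (complex_of_real x) = 1 / 2 * ln ((1 + x) / (1 - x))"
  using assms by (simp add: poincare_dist_def)

lemma kobayashi_dist_le_chain:
  assumes "m \<ge> 1" "p 0 = z" "p m = w"
    and "\<And>j. j < m \<Longrightarrow> holomorphic_disc \<Omega> (f j) \<and> a j \<in> ball 0 1 \<and> b j \<in> ball 0 1 \<and>
            f j (a j) = p j \<and> f j (b j) = p (Suc j)"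
  shows "kobayashi_dist \<Omega> z w \<le> (\<Sum>j<m. poincare_dist (a j) (b j))"
  unfolding kobayashi_dist_def
proof (rule cInf_lower)
  show "(\<Sum>j<m. poincare_dist (a j) (b j)) \<in> {\<Sum>j<m. poincare_dist (a j) (b j) | m p f a b.
     m \<ge> (1::nat) \<and> p 0 = z \<and> p m = w \<and>
     (\<forall>j<m. holomorphic_disc \<Omega> (f j) \<and> a j \<in> ball 0 1 \<and> b j \<in> ball 0 1 \<and>
            f j (a j) = p j \<and> f j (b j) = p (Suc j))}"
    using assms by blast
qed (rule bdd_belowI[where m = 0], use poincare_dist_nonneg in \<open>auto intro!: sum_nonneg\<close>)

lemma norm_vector_scalar_mult: "norm (c *s x) = norm c * norm (x :: complex ^ 'n)"
  by (simp add: norm_vec_def norm_mult L2_set_right_distrib)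

lemma inner_i_vector_scalar_mult: "(x :: complex ^ 'n) \<bullet> (\<i> *s x) = 0"
  by (simp add: inner_vec_def inner_complex_def mult.commute)

lemma vector_scalar_mult_complex:
  "c *s (x :: complex ^ 'n) = Re c *\<^sub>R x + Im c *\<^sub>R (\<i> *s x)"
  by (simp add: vec_eq_iff complex_eq_iff)

lemma of_real_vector_scalar_mult: "complex_of_real a *s (x :: complex ^ 'n) = a *\<^sub>R x"
  by (simp add: vec_eq_iff complex_eq_iff)

text \<open>The segment from \<open>z\<^sub>0\<close> to \<open>p\<close> is cut into
  \<open>N\<close> equal steps. By convexity the balls of radius \<open>m\<close> at its two ends
  span a tube inside \<open>\<Omega>\<close>, so each step fits into an affine disc at a fixed
  Poincare cost; the disc \<open>f\<close> is appended as the last link.\<close>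

lemma kobayashi_dist_le_convex:
  fixes \<Omega> :: "(complex ^ 'n) set"
  assumes "convex \<Omega>" "m > 0" "ball z\<^sub>0 m \<subseteq> \<Omega>" "ball p m \<subseteq> \<Omega>"
    and N: "N \<ge> (1::nat)" "norm (p - z\<^sub>0) / N \<le> m / 2"
    and f: "holomorphic_disc \<Omega> f" "a \<in> ball 0 1" "b \<in> ball 0 1" "f a = p" "f b = z"
  shows "kobayashi_dist \<Omega> z\<^sub>0 z \<le> N * poincare_dist 0 (1/2) + poincare_dist a b"
proof -
  define q where "q j = z\<^sub>0 + (real j / N) *\<^sub>R (p - z\<^sub>0)" for j
  \<comment> \<open>The radius \<open>2 * norm (p - z\<^sub>0) / N\<close> is at most
    \<open>m\<close>, and the factor 2 puts the next division point at the parameter 1/2, well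
    inside the unit disc.\<close>
  define g where "g j \<zeta> = q j + (2 * \<zeta> / N) *s (p - z\<^sub>0)" for j and \<zeta> :: complex
  have ball: "q j + u \<in> \<Omega>" if "j \<le> N" "norm u < m" for j u
  proof -
    define t where "t = real j / N"
    have "0 \<le> t" "t \<le> 1" using that N by (auto simp: t_def)
    moreover have "z\<^sub>0 + u \<in> \<Omega>" "p + u \<in> \<Omega>" using assms that by (auto simp: subset_iff dist_norm)
    ultimately have "(1 - t) *\<^sub>R (z\<^sub>0 + u) + t *\<^sub>R (p + u) \<in> \<Omega>"
      using \<open>convex \<Omega>\<close> by (intro convexD) auto
    moreover have "(1 - t) *\<^sub>R (z\<^sub>0 + u) + t *\<^sub>R (p + u) = q j + u"
      by (simp add: q_def t_def[symmetric] algebra_simps)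
    ultimately show ?thesis by simp
  qed
  have disc: "holomorphic_disc \<Omega> (g j)" if "j < N" for j
  proof -
    have "g j \<zeta> \<in> \<Omega>" if "\<zeta> \<in> ball 0 1" for \<zeta>
      unfolding g_def
    proof (rule ball)
      have "norm ((2 * \<zeta> / N) *s (p - z\<^sub>0)) = 2 * norm \<zeta> * (norm (p - z\<^sub>0) / N)"
        unfolding norm_vector_scalar_mult by (simp add: norm_mult norm_divide)
      also have "\<dots> \<le> 2 * norm \<zeta> * (m / 2)" using N by (intro mult_left_mono) auto
      also have "\<dots> < m" using that \<open>m > 0\<close> by simp
      finally show "norm ((2 * \<zeta> / N) *s (p - z\<^sub>0)) < m" .
    qed (use \<open>j < N\<close> in simp)
    then show ?thesis
      by (auto simp: holomorphic_disc_def g_def divide_inverse intro!: holomorphic_intros)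
  qed
  have half: "g j (1/2) = q (Suc j)" for j
  proof -
    have "2 * (1/2) / complex_of_nat N = of_real (1 / N)" by simp
    then have "g j (1/2) = q j + (1 / N) *\<^sub>R (p - z\<^sub>0)"
      unfolding g_def by (simp only: of_real_vector_scalar_mult)
    then show ?thesis
      by (simp add: q_def add_divide_distrib scaleR_left_distrib)
  qed
  have q: "q 0 = z\<^sub>0" "q N = p" using N by (auto simp: q_def)
  have g0: "g j 0 = q j" for j by (simp add: g_def)
  \<comment> \<open>Links 0 to \<open>N - 1\<close> are the affine steps; link \<open>N\<close> is
    \<open>f\<close>, which ends at \<open>z\<close>.\<close>
  have "kobayashi_dist \<Omega> z\<^sub>0 z \<le> (\<Sum>j<Suc N. poincare_dist (if j < N then 0 else a) (if j < N then 1/2 else b))"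
  proof (rule kobayashi_dist_le_chain)
    fix j assume "j < Suc N"
    then consider "j < N" | "j = N" by linarith
    then show "holomorphic_disc \<Omega> (if j < N then g j else f) \<and> (if j < N then 0 else a) \<in> ball 0 1 \<and>
      (if j < N then 1/2 else b) \<in> ball 0 1 \<and>
      (if j < N then g j else f) (if j < N then 0 else a) = (if j \<le> N then q j else z) \<and>
      (if j < N then g j else f) (if j < N then 1/2 else b) = (if Suc j \<le> N then q (Suc j) else z)"
      by cases (simp_all add: f[simplified] q g0 half disc)
  qed (simp_all add: q)
  also have "\<dots> = (\<Sum>j<N. poincare_dist 0 (1/2)) + poincare_dist a b"
    unfolding sum.lessThan_Suc by (intro arg_cong2[of _ _ _ _ "(+)"] sum.cong) simp_all
  also have "\<dots> = N * poincare_dist 0 (1/2) + poincare_dist a b" by simp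
  finally show ?thesis .
qed

section \<open>The Dini condition and a holomorphic map above the modulus\<close>

text \<open>The Dini integral over the dyadic interval \<open>[r / 2\<^sup>k, 2r / 2\<^sup>k)\<close> is at least \<open>\<omega> (r / 2\<^sup>k) / 2\<close>.\<close>

lemma dini_summable:
  assumes "dini_condition (2 * r) \<omega>" "mono_on {0..<2*r} \<omega>"
  shows "summable (\<lambda>k. \<omega> (r / 2 ^ k))"
proof -
  define I where "I = (\<integral>\<^sup>+ t\<in>{0..<2*r}. ennreal (\<omega> t / t) \<partial>lebesgue)"
  define J where "J k = {r / 2 ^ k..<2 * r / 2 ^ k}" for k :: nat
  have r: "r > 0" and nn: "\<And>t. t \<in> {0..<2*r} \<Longrightarrow> 0 \<le> \<omega> t" and I: "I < \<infinity>"
    using assms by (auto simp: dini_condition_def I_def)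
  have bd: "r / 2 ^ k \<in> {0..<2*r}" for k
  proof -
    have "r / 2 ^ k \<le> r / 1" using r by (intro divide_left_mono) auto
    then show ?thesis using r by auto
  qed
  have JJ: "J k \<subseteq> {0..<2*r}" for k
  proof -
    have "2 * r / 2 ^ k \<le> 2 * r / 1" using r by (intro divide_left_mono) auto
    moreover have "0 \<le> r / 2 ^ k" using r by simp
    ultimately show ?thesis unfolding J_def by auto
  qed
  have disj: "t \<notin> J j" if "t \<in> J i" "i < j" for i j t
  proof -
    have "2 * (2::real) ^ i \<le> 2 ^ j"
      using that by (metis Suc_leI power_Suc power_increasing one_le_numeral)
    then have "2 * r / 2 ^ j \<le> r / 2 ^ i" using r by (simp add: field_simps)
    then show ?thesis using that by (auto simp: J_def)
  qed
  have partial: "(\<Sum>k<K. ennreal (\<omega> (r / 2 ^ k) / 2)) \<le> I" for K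
  proof -
    \<comment> \<open>On \<open>J k\<close> monotonicity bounds the numerator of
      \<open>\<omega> t / t\<close> below by its value at the left end, and the right end bounds the
      denominator above. So \<open>c k\<close> is a lower bound for the integrand; times the length
      \<open>r / 2 ^ k\<close> it gives \<open>\<omega> (r / 2 ^ k) / 2\<close>.\<close>
    define c where "c k = ennreal (\<omega> (r / 2 ^ k) / (2 * r / 2 ^ k))" for k :: nat
    have "(\<Sum>k<K. ennreal (\<omega> (r / 2 ^ k) / 2)) = (\<Sum>k<K. c k * emeasure lebesgue (J k))"
    proof (rule sum.cong)
      fix k
      have "emeasure lebesgue (J k) = ennreal (r / 2 ^ k)"
        using r by (simp add: J_def divide_right_mono)
      then show "ennreal (\<omega> (r / 2 ^ k) / 2) = c k * emeasure lebesgue (J k)"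
        using r nn[OF bd[of k]] by (simp add: c_def ennreal_mult[symmetric] field_simps)
    qed simp
    also have "\<dots> = (\<integral>\<^sup>+ t. (\<Sum>k<K. c k * indicator (J k) t) \<partial>lebesgue)"
      by (subst nn_integral_sum)
         (auto simp: J_def nn_integral_cmult_indicator
           intro!: borel_measurable_times_ennreal borel_measurable_indicator)
    also have "\<dots> \<le> I"
      unfolding I_def
    proof (rule nn_integral_mono)
      fix t
      show "(\<Sum>k<K. c k * indicator (J k) t) \<le> ennreal (\<omega> t / t) * indicator {0..<2*r} t"
      proof (cases "\<exists>j<K. t \<in> J j")
        case True
        then obtain j where j: "j < K" "t \<in> J j" by auto
        have iff: "t \<in> J i \<longleftrightarrow> i = j" for i
          using disj[of t i j] disj[of t j i] j by (cases i j rule: linorder_cases) auto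
        have "(\<Sum>k<K. c k * indicator (J k) t) = (\<Sum>k<K. if k = j then c j else 0)"
          by (intro sum.cong) (auto simp: indicator_def iff)
        also have "\<dots> = c j" using j by simp
        also have "\<dots> \<le> ennreal (\<omega> t / t)"
          unfolding c_def
        proof (intro ennreal_leI frac_le)
          show "\<omega> (r / 2 ^ j) \<le> \<omega> t"
            using j bd[of j] JJ[of j] by (intro mono_onD[OF assms(2)]) (auto simp: J_def)
          show "0 \<le> \<omega> t" using nn j JJ[of j] by blast
          have "0 < r / 2 ^ j" using r by simp
          then show "0 < t" "t \<le> 2 * r / 2 ^ j" using j unfolding J_def by auto
        qed
        finally show ?thesis using j JJ[of j] by (auto simp: indicator_def)
      qed (auto simp: indicator_def intro!: sum_nonneg)
    qed
    finally show ?thesis .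
  qed
  have "summable (\<lambda>k. \<omega> (r / 2 ^ k) / 2)"
  proof (rule bounded_imp_summable)
    fix K
    have "ennreal (\<Sum>k<Suc K. \<omega> (r / 2 ^ k) / 2) \<le> I"
      using partial[of "Suc K"] nn bd by (subst sum_ennreal[symmetric]) auto
    also have "I = ennreal (enn2real I)" using I by simp
    finally show "(\<Sum>k\<le>K. \<omega> (r / 2 ^ k) / 2) \<le> enn2real I"
      by (simp add: lessThan_Suc_atMost)
  qed (use nn bd in auto)
  then show ?thesis by simp
qed

text \<open>Expanding with the conjugate, the real part is
  \<open>(norm w)\<^sup>2 + s * Re w\<close> over the squared norm of the denominator. Dropping
  \<open>s * Re w\<close> and using the triangle inequality gives the first bound; the second holds
  because adding \<open>s\<close> to a point of the right half-plane gives modulus at least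
  \<open>s\<close>.\<close>

lemma Re_divide_add_of_real:
  assumes "Re w > 0" "0 < s"
  shows "(norm w)\<^sup>2 / (norm w + s)\<^sup>2 \<le> Re (w / (w + of_real s))"
    and "norm (w / (w + of_real s)) \<le> norm w / s"
proof -
  define n where "n = norm (w + of_real s)"
  have nz: "w + of_real s \<noteq> 0" using assms by (auto simp: complex_eq_iff)
  have n: "n > 0" "n \<le> norm w + s"
    using nz norm_triangle_ineq[of w "of_real s"] assms by (auto simp: n_def)
  have "Re (w / (w + of_real s)) = ((norm w)\<^sup>2 + s * Re w) / n\<^sup>2"
    by (simp add: n_def Re_divide cmod_power2) (simp add: power2_eq_square algebra_simps)
  moreover have "(norm w)\<^sup>2 / (norm w + s)\<^sup>2 \<le> (norm w)\<^sup>2 / n\<^sup>2"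
    using n by (intro divide_left_mono power_mono) auto
  moreover have "(norm w)\<^sup>2 / n\<^sup>2 \<le> ((norm w)\<^sup>2 + s * Re w) / n\<^sup>2"
    using assms by (intro divide_right_mono) auto
  ultimately show "(norm w)\<^sup>2 / (norm w + s)\<^sup>2 \<le> Re (w / (w + of_real s))" by simp
  have "s \<le> n" using assms complex_Re_le_cmod[of "w + of_real s"] by (simp add: n_def)
  then show "norm (w / (w + of_real s)) \<le> norm w / s"
    using assms n by (simp add: norm_divide n_def[symmetric] divide_left_mono)
qed

text \<open>The norm bound controls \<open>Im (h w)\<close> by \<open>2 * norm w\<close>, which
  explains the argument of \<open>\<omega>\<close> in the lower bound: together they place
  \<open>h w\<close> above the graph of a multiple of
  \<open>\<bar>y\<bar> * \<omega> \<bar>y\<bar>\<close>, where \<open>y\<close> is its imaginary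
  part. Reality on the axis keeps the image of the axis on the normal line.\<close>

lemma holomorphic_map_above_modulus:
  fixes \<omega> :: "real \<Rightarrow> real"
  assumes "r > 0" "A > 0" and nn: "\<forall>t\<in>{0..<2*r}. 0 \<le> \<omega> t"
    and mono: "mono_on {0..<2*r} \<omega>" and summ: "summable (\<lambda>k. \<omega> (r / 2 ^ k))"
  shows "\<exists>\<theta> h. 0 < \<theta> \<and> \<theta> < r \<and> h holomorphic_on {w. Re w > 0 \<and> norm w < \<theta>} \<and>
    (\<forall>w. Re w > 0 \<longrightarrow> norm w < \<theta> \<longrightarrow> norm (h w) \<le> 2 * norm w) \<and>
    (\<forall>w. Re w > 0 \<longrightarrow> norm w < \<theta> \<longrightarrow> Re w + A * norm w * \<omega> (2 * norm w) \<le> Re (h w)) \<and>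
    (\<forall>x. 0 < x \<longrightarrow> x < \<theta> \<longrightarrow> h (of_real x) \<in> \<real>)"
proof -
  have om: "0 \<le> \<omega> (r / 2 ^ k)" for k
  proof (rule bspec[OF nn])
    have "r / 2 ^ k \<le> r / 1" using assms(1) by (intro divide_left_mono) auto
    then show "r / 2 ^ k \<in> {0..<2*r}" using assms(1) by auto
  qed
  \<comment> \<open>Only a tail of the series enters, so small that the \<open>c k\<close> below sum
    to at most 1; this gives \<open>norm (h w) \<le> 2 * norm w\<close>.\<close>
  obtain N where N: "(\<Sum>k. \<omega> (r / 2 ^ (k + N))) < 1 / (9 * A)"
  proof -
    have "(\<lambda>N. \<Sum>k. \<omega> (r / 2 ^ (k + N))) \<longlonglongrightarrow> 0"
      by (rule suminf_exist_split2[OF summ])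
    then have "eventually (\<lambda>N. (\<Sum>k. \<omega> (r / 2 ^ (k + N))) < 1 / (9 * A)) sequentially"
      using assms(2) by (intro order_tendstoD) auto
    then show ?thesis using that by (auto simp: eventually_sequentially)
  qed
  \<comment> \<open>The shift by \<open>Suc N\<close> makes \<open>2 * s k\<close> run through the
    sample points of that tail. The argument \<open>2 * s k\<close> in \<open>c k\<close> matches
    \<open>\<omega> (2 * norm w)\<close>, and the 9 pays for the estimate
    \<open>(n + s j)\<^sup>2 \<le> (3 * n)\<^sup>2\<close> at the end.\<close>
  define s where "s k = r / 2 ^ (k + Suc N)" for k
  define c where "c k = 9 * A * \<omega> (2 * s k)" for k
  have s2: "2 * s k = r / 2 ^ (k + N)" for k by (simp add: s_def field_simps)
  have s0: "s k > 0" for k using assms by (simp add: s_def)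
  have c0: "0 \<le> c k" for k using om[of "k + N"] assms by (simp add: c_def s2)
  have csum: "summable c"
    unfolding c_def s2 using summable_ignore_initial_segment[OF summ] by (rule summable_mult)
  have cle: "suminf c \<le> 1"
  proof -
    have "suminf c = 9 * A * (\<Sum>k. \<omega> (r / 2 ^ (k + N)))"
      unfolding c_def s2 using summable_ignore_initial_segment[OF summ] by (rule suminf_mult)
    also have "\<dots> \<le> 9 * A * (1 / (9 * A))" using N assms by (intro mult_left_mono) auto
    finally show ?thesis using assms by simp
  qed
  \<comment> \<open>The factor \<open>s k\<close> offsets the bound \<open>norm w / s k\<close> on
    the quotient, so \<open>c k * norm w\<close> dominates the term and the series converges on the
    whole right half-plane.\<close>
  define u where "u k w = of_real (c k * s k) * (w / (w + of_real (s k)))" for k and w :: complex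
  define h where "h w = w + (\<Sum>k. u k w)" for w
  define S where "S = {w. Re w > 0 \<and> norm w < s 0}"
  have ule: "norm (u k w) \<le> c k * norm w" if "Re w > 0" for k w
  proof -
    have "norm (u k w) = c k * s k * norm (w / (w + of_real (s k)))"
      unfolding u_def norm_mult using c0[of k] s0[of k] by (simp add: norm_mult)
    also have "\<dots> \<le> c k * s k * (norm w / s k)"
      using c0[of k] s0[of k] Re_divide_add_of_real(2)[OF that s0[of k]] by (intro mult_left_mono) auto
    also have "\<dots> = c k * norm w" using s0[of k] by simp
    finally show ?thesis .
  qed
  have nsum: "summable (\<lambda>k. norm (u k w))" if "Re w > 0" for w
    by (rule summable_comparison_test'[OF summable_mult2[OF csum, of "norm w"], of 0])
       (simp add: ule[OF that])
  note usum = summable_norm_cancel[OF nsum]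
  have unif: "uniform_limit S (\<lambda>n w. \<Sum>k<n. u k w) (\<lambda>w. \<Sum>k. u k w) sequentially"
  proof (rule Weierstrass_m_test)
    show "summable (\<lambda>k. c k * s 0)" using csum by (intro summable_mult2)
    fix k w assume w: "w \<in> S"
    then have "c k * norm w \<le> c k * s 0" using c0 by (intro mult_left_mono) (auto simp: S_def)
    then show "norm (u k w) \<le> c k * s 0" using ule[of w k] w by (auto simp: S_def)
  qed
  have "open S"
  proof -
    have "S = {w. Re w > 0} \<inter> ball 0 (s 0)" by (auto simp: S_def)
    then show ?thesis by (auto intro: open_halfspace_Re_gt)
  qed
  have "(\<lambda>w. \<Sum>k. u k w) holomorphic_on S"
  proof (rule holomorphic_uniform_sequence[OF \<open>open S\<close>])
    fix n show "(\<lambda>w. \<Sum>k<n. u k w) holomorphic_on S"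
      unfolding u_def
    proof (intro holomorphic_intros)
      fix k w assume "w \<in> S"
      then show "w + of_real (s k) \<noteq> 0" using s0[of k] by (auto simp: complex_eq_iff S_def)
    qed
  next
    fix w assume "w \<in> S"
    then obtain d where d: "d > 0" "cball w d \<subseteq> S" using \<open>open S\<close> by (auto simp: open_contains_cball)
    then show "\<exists>d>0. cball w d \<subseteq> S \<and> uniform_limit (cball w d) (\<lambda>n w. \<Sum>k<n. u k w) (\<lambda>w. \<Sum>k. u k w) sequentially"
      using uniform_limit_on_subset[OF unif] by blast
  qed
  then have hol: "h holomorphic_on S"
    unfolding h_def by (intro holomorphic_intros)
  show ?thesis
  proof (intro exI[of _ "s 0"] exI[of _ h] conjI allI impI)
    show "0 < s 0" by (rule s0)
    show "s 0 < r"
    proof -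
      have "(1::real) < 2 ^ Suc N" by (rule one_less_power) auto
      then show ?thesis using assms by (simp add: s_def field_simps)
    qed
    show "h holomorphic_on {w. Re w > 0 \<and> norm w < s 0}" using hol by (simp add: S_def)
    fix w :: complex assume w: "Re w > 0" "norm w < s 0"
    have "norm (\<Sum>k. u k w) \<le> (\<Sum>k. norm (u k w))" by (rule summable_norm[OF nsum[OF w(1)]])
    also have "\<dots> \<le> (\<Sum>k. c k * norm w)"
      using w csum by (intro suminf_le ule nsum summable_mult2)
    also have "\<dots> = suminf c * norm w" using csum by (rule suminf_mult2[symmetric])
    also have "\<dots> \<le> 1 * norm w" using cle by (intro mult_right_mono) auto
    finally show "norm (h w) \<le> 2 * norm w"
      unfolding h_def using norm_triangle_ineq[of w "\<Sum>k. u k w"] by linarith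
    \<comment> \<open>This bound is nonnegative, so all terms but one can be discarded
      later.\<close>
    have Reu: "c k * s k * ((norm w)\<^sup>2 / (norm w + s k)\<^sup>2) \<le> Re (u k w)" for k
    proof -
      have "Re (u k w) = c k * s k * Re (w / (w + of_real (s k)))"
        unfolding u_def by (simp only: Re_complex_of_real Im_complex_of_real times_complex.sel mult_zero_left diff_0_right)
      then show ?thesis
        using mult_left_mono[OF Re_divide_add_of_real(1)[OF w(1) s0[of k]], of "c k * s k"] c0[of k] s0[of k]
        by simp
    qed
    define n where "n = norm w"
    have n: "n > 0" using w by (auto simp: n_def)
    \<comment> \<open>the summand at the dyadic scale of \<open>w\<close>\<close>
    obtain j where j: "n \<le> s j" "s j \<le> 2 * n"
    proof -
      have "\<exists>k. s k < n"
      proof -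
        obtain k where "s 0 / n < 2 ^ k" using real_arch_pow[of 2 "s 0 / n"] by auto
        then have "s k < n" using n by (simp add: s_def field_simps power_add)
        then show ?thesis by blast
      qed
      \<comment> \<open>The first scale below \<open>n\<close> is not \<open>s 0\<close>, as
        \<open>n < s 0\<close>. Its predecessor \<open>s j\<close> is therefore at least
        \<open>n\<close>, and being twice \<open>s k\<close> it is below
        \<open>2 * n\<close>.\<close>
      moreover define k where "k = (LEAST k. s k < n)"
      ultimately have k: "s k < n" by (auto intro: LeastI_ex)
      with w have "k \<noteq> 0" unfolding n_def by (metis not_less_iff_gr_or_eq)
      then obtain j where j: "k = Suc j" by (cases k) auto
      have "\<not> s j < n" using not_less_Least[of j "\<lambda>k. s k < n"] j by (simp add: k_def)
      moreover have "s j = 2 * s k" by (simp add: s_def j)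
      ultimately show ?thesis using that[of j] k by linarith
    qed
    have "A * n * \<omega> (2 * n) \<le> A * n * \<omega> (2 * s j)"
    proof (intro mult_left_mono mono_onD[OF mono])
      have "2 * s j \<le> r / 1"
        unfolding s2 using assms by (intro divide_left_mono) auto
      then show "2 * n \<in> {0..<2*r}" "2 * s j \<in> {0..<2*r}"
        using j n assms by auto
    qed (use n assms j in auto)
    also have "\<dots> = c j * (n / 9)" by (simp add: c_def)
    also have "\<dots> \<le> c j * (s j * (n\<^sup>2 / (n + s j)\<^sup>2))"
    proof (rule mult_left_mono[OF _ c0])
      have "n * (n + s j)\<^sup>2 \<le> n * (3 * n)\<^sup>2" using j n by (intro mult_left_mono power_mono) auto
      also have "\<dots> = 9 * (n * n\<^sup>2)" by (simp add: power2_eq_square)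
      also have "\<dots> \<le> 9 * (s j * n\<^sup>2)" using j by (intro mult_left_mono mult_right_mono) auto
      finally have "n * (n + s j)\<^sup>2 \<le> 9 * (s j * n\<^sup>2)" .
      moreover have "(n + s j)\<^sup>2 > 0" using n j by simp
      ultimately show "n / 9 \<le> s j * (n\<^sup>2 / (n + s j)\<^sup>2)"
        by (simp add: divide_simps mult.commute mult.left_commute)
    qed
    also have "\<dots> \<le> Re (u j w)" using Reu[of j] by (simp add: n_def mult.assoc)
    also have "\<dots> = (\<Sum>k\<in>{j}. Re (u k w))" by simp
    also have "\<dots> \<le> (\<Sum>k. Re (u k w))"
    proof (rule sum_le_suminf)
      show "summable (\<lambda>k. Re (u k w))" using usum[OF w(1)] by (rule summable_Re)
      fix k
      have "0 \<le> c k * s k * ((norm w)\<^sup>2 / (norm w + s k)\<^sup>2)" using c0[of k] s0[of k] by auto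
      then show "0 \<le> Re (u k w)" using Reu[of k] by linarith
    qed auto
    also have "\<dots> = Re (\<Sum>k. u k w)" using usum[OF w(1)] by (rule Re_suminf[symmetric])
    finally show "Re w + A * norm w * \<omega> (2 * norm w) \<le> Re (h w)" by (simp add: h_def n_def)
  next
    fix x :: real assume "0 < x" "x < s 0"
    then have "summable (\<lambda>k. u k (of_real x))" by (intro usum) auto
    moreover have "u k (of_real x) = of_real (c k * s k * (x / (x + s k)))" for k
      by (simp add: u_def)
    ultimately have "Im (\<Sum>k. u k (of_real x)) = 0" by (subst Im_suminf) auto
    then show "h (of_real x) \<in> \<real>" by (simp add: h_def complex_is_Real_iff)
  qed
qed


section \<open>Boundary geometry and the sign of the defining function\<close>

text \<open>A vector with positive \<open>\<eta>\<close>-component points from \<open>\<xi>\<close>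
  into the ball around \<open>z\<close>, where \<open>\<rho>\<close> is nonpositive. So
  \<open>L\<close> is nonpositive on that open half-space and, by a limit, on the hyperplane
  orthogonal to \<open>\<eta>\<close>. Applied to a vector and its negative this makes
  \<open>L\<close> vanish on the hyperplane.\<close>

lemma derivative_at_interior_ball:
  fixes L :: "'a::euclidean_space \<Rightarrow> real"
  assumes der: "(\<rho> has_derivative L) (at \<xi>)" and U: "open U" "\<xi> \<in> U" and "\<rho> \<xi> = 0"
    and neg: "\<And>x. x \<in> U \<Longrightarrow> dist z x < d \<Longrightarrow> \<rho> x \<le> 0"
    and \<eta>: "norm \<eta> = 1" "z = \<xi> + d *\<^sub>R \<eta>" "d > 0"
  shows "L v = L \<eta> * (\<eta> \<bullet> v)" and "L \<eta> \<le> 0"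
proof -
  interpret L: bounded_linear L using der by (rule has_derivative_bounded_linear)
  have key: "L w \<le> 0" if w: "\<eta> \<bullet> w > 0" for w
  proof (rule ccontr)
    assume "\<not> L w \<le> 0"
    moreover have "((\<lambda>t. \<rho> (\<xi> + t *\<^sub>R w)) has_derivative (\<lambda>t. L (t *\<^sub>R w))) (at 0)"
      by (rule has_derivative_compose[of "\<lambda>t. \<xi> + t *\<^sub>R w" "\<lambda>t. t *\<^sub>R w" 0 UNIV \<rho> L])
         (use der in \<open>auto intro!: derivative_eq_intros\<close>)
    then have "((\<lambda>t. \<rho> (\<xi> + t *\<^sub>R w)) has_real_derivative L w) (at 0)"
      by (simp add: has_field_derivative_def L.scaleR mult_commute_abs)
    ultimately obtain e where e: "e > 0" "\<And>t. 0 < t \<Longrightarrow> t < e \<Longrightarrow> \<rho> \<xi> < \<rho> (\<xi> + t *\<^sub>R w)"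
      using has_real_derivative_pos_inc_right[of "\<lambda>t. \<rho> (\<xi> + t *\<^sub>R w)" "L w" 0 UNIV] by auto
    obtain e' where e': "e' > 0" "ball \<xi> e' \<subseteq> U" using U open_contains_ball by blast
    have w0: "norm w > 0" using w by auto
    \<comment> \<open>The three bounds keep the point where \<open>\<rho>\<close> would exceed
      \<open>\<rho> \<xi>\<close>, in \<open>U\<close>, and in the ball around \<open>z\<close>; the
      last because the squared distance to \<open>z\<close> is \<open>d\<^sup>2 - t * (2 * d *
      (\<eta> \<bullet> w) - t * (norm w)\<^sup>2)\<close>.\<close>
    define t where "t = min (min (e / 2) (e' / (2 * norm w))) (d * (\<eta> \<bullet> w) / (norm w)\<^sup>2)"
    have t: "0 < t" "t < e" using e e' w w0 \<eta> by (auto simp: t_def)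
    have "t * norm w \<le> e' / (2 * norm w) * norm w"
      by (intro mult_right_mono) (auto simp: t_def)
    also have "\<dots> = e' / 2" using w0 by simp
    finally have "t * norm w \<le> e' / 2" .
    then have "\<xi> + t *\<^sub>R w \<in> U" using e' t by (auto simp: subset_iff dist_norm)
    moreover have "dist z (\<xi> + t *\<^sub>R w) < d"
    proof -
      have "t * (norm w)\<^sup>2 \<le> d * (\<eta> \<bullet> w) / (norm w)\<^sup>2 * (norm w)\<^sup>2"
        by (intro mult_right_mono) (auto simp: t_def)
      also have "\<dots> = d * (\<eta> \<bullet> w)" using w0 by simp
      moreover have "d * (\<eta> \<bullet> w) > 0" using w \<eta> by simp
      ultimately have "t * (norm w)\<^sup>2 < 2 * d * (\<eta> \<bullet> w)" by linarith
      then have "t * (t * (norm w)\<^sup>2) < t * (2 * d * (\<eta> \<bullet> w))" using t by simp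
      moreover have "(norm (d *\<^sub>R \<eta> - t *\<^sub>R w))\<^sup>2 = d\<^sup>2 * (norm \<eta>)\<^sup>2 - t * (2 * d * (\<eta> \<bullet> w)) + t * (t * (norm w)\<^sup>2)"
        by (simp only: power2_norm_eq_inner) (simp add: inner_diff inner_commute algebra_simps power2_eq_square)
      ultimately have "(norm (d *\<^sub>R \<eta> - t *\<^sub>R w))\<^sup>2 < d\<^sup>2" using \<eta> by simp
      then have "norm (d *\<^sub>R \<eta> - t *\<^sub>R w) < d"
        by (rule power2_less_imp_less) (use \<eta> in simp)
      then show ?thesis using \<eta> by (simp add: dist_norm)
    qed
    ultimately have "\<rho> (\<xi> + t *\<^sub>R w) \<le> 0" by (rule neg)
    then show False using e(2)[of t] t \<open>\<rho> \<xi> = 0\<close> by simp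
  qed
  have \<eta>1: "\<eta> \<bullet> \<eta> = 1" using \<eta> by (simp add: norm_eq_1)
  show "L \<eta> \<le> 0" by (rule key) (simp add: \<eta>1)
  \<comment> \<open>Tilting \<open>w\<close> by a small multiple of \<open>\<eta>\<close> moves it
    into the half-space of \<open>key\<close>; the added 1 in \<open>e'\<close> avoids division by
    zero when \<open>L \<eta> = 0\<close>.\<close>
  have perp: "L w \<le> 0" if "\<eta> \<bullet> w = 0" for w
  proof (rule field_le_epsilon)
    fix e :: real assume "e > 0"
    define e' where "e' = e / (\<bar>L \<eta>\<bar> + 1)"
    have "e' > 0" using \<open>e > 0\<close> by (simp add: e'_def add_nonneg_pos)
    then have "L (w + e' *\<^sub>R \<eta>) \<le> 0" using that by (intro key) (simp add: inner_add_right \<eta>1)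
    then have "L w \<le> e' * \<bar>L \<eta>\<bar>" using \<open>L \<eta> \<le> 0\<close> by (simp add: L.add L.scaleR)
    also have "\<dots> \<le> e' * (\<bar>L \<eta>\<bar> + 1)" using \<open>e' > 0\<close> by simp
    also have "\<dots> = e" by (simp add: e'_def add_nonneg_eq_0_iff)
    finally show "L w \<le> 0 + e" by simp
  qed
  define w where "w = v - (\<eta> \<bullet> v) *\<^sub>R \<eta>"
  have "\<eta> \<bullet> w = 0" by (simp add: w_def inner_diff_right \<eta>1)
  moreover from this have "\<eta> \<bullet> (- w) = 0" by simp
  ultimately have "L w \<le> 0" "L (- w) \<le> 0" by (simp_all only: perp)
  then have "L w = 0" unfolding L.neg by linarith
  moreover have "L w = L v - (\<eta> \<bullet> v) * L \<eta>" unfolding w_def L.diff L.scaleR by simp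
  ultimately show "L v = L \<eta> * (\<eta> \<bullet> v)" by simp
qed

text \<open>The frontier avoids the open ball, so along a curve in it the squared distance to
  \<open>z\<close> is minimal at \<open>\<xi>\<close> and its derivative
  \<open>2 * ((\<xi> - z) \<bullet> v)\<close> vanishes. This makes the hypothesis on normals
  available at a boundary point nearest to \<open>z\<close>.\<close>

lemma inward_unit_normal_nearest:
  fixes \<Omega> :: "'a::euclidean_space set"
  assumes "open \<Omega>" and "ball z d \<subseteq> \<Omega>" and \<eta>: "norm \<eta> = 1" "z = \<xi> + d *\<^sub>R \<eta>" "d > 0"
  shows "inward_unit_normal \<Omega> \<xi> \<eta>"
  unfolding inward_unit_normal_def
proof (intro conjI ballI)
  show "norm \<eta> = 1" by (rule \<eta>)
  show "\<exists>\<epsilon>>0. \<forall>t. 0 < t \<and> t < \<epsilon> \<longrightarrow> \<xi> + t *\<^sub>R \<eta> \<in> \<Omega>"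
  proof (intro exI[of _ d] conjI allI impI)
    fix t assume t: "0 < t \<and> t < d"
    have "dist z (\<xi> + t *\<^sub>R \<eta>) = norm ((d - t) *\<^sub>R \<eta>)" by (simp add: \<eta> dist_norm algebra_simps)
    also have "\<dots> < d" using t \<eta> by simp
    finally show "\<xi> + t *\<^sub>R \<eta> \<in> \<Omega>" using assms by auto
  qed (rule \<eta>)
next
  fix v assume "v \<in> tangent_vectors (frontier \<Omega>) \<xi>"
  then obtain \<gamma> e where \<gamma>: "\<gamma> 0 = \<xi>" "e > 0" "\<And>t. \<bar>t\<bar> < e \<Longrightarrow> \<gamma> t \<in> frontier \<Omega>"
    and d: "(\<gamma> has_vector_derivative v) (at 0)"
    by (auto simp: tangent_vectors_def)
  have "((\<lambda>t. (\<gamma> t - z) \<bullet> (\<gamma> t - z)) has_real_derivative 2 * ((\<xi> - z) \<bullet> v)) (at 0)"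
    using d unfolding has_vector_derivative_def has_field_derivative_def
    by (auto intro!: derivative_eq_intros simp: \<gamma> inner_commute)
  moreover have "(\<gamma> 0 - z) \<bullet> (\<gamma> 0 - z) \<le> (\<gamma> t - z) \<bullet> (\<gamma> t - z)" if "\<bar>0 - t\<bar> < e" for t
  proof -
    have "\<gamma> t \<in> frontier \<Omega>" using \<gamma> that by auto
    then have "\<gamma> t \<notin> ball z d" using \<open>open \<Omega>\<close> assms(2) by (auto simp: frontier_def interior_open)
    then have "d \<le> norm (\<gamma> t - z)" by (simp add: dist_norm norm_minus_commute)
    moreover have "norm (\<gamma> 0 - z) = d" using \<eta> \<gamma> by simp
    ultimately have "(norm (\<gamma> 0 - z))\<^sup>2 \<le> (norm (\<gamma> t - z))\<^sup>2" using \<eta> by (intro power_mono) auto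
    then show ?thesis by (simp add: power2_norm_eq_inner)
  qed
  ultimately have "2 * ((\<xi> - z) \<bullet> v) = 0"
    using \<open>e > 0\<close> by (intro DERIV_local_min[of _ _ 0 e]) auto
  then show "\<eta> \<bullet> v = 0" using \<eta> by simp
qed

text \<open>\<open>K\<close> is covered by open sets on which \<open>f\<close> oscillates by less
  than \<open>e\<close>, and \<open>\<delta>\<close> is a Lebesgue number of this cover. Uniform
  continuity on \<open>K\<close> alone would not do, since \<open>x\<close> may lie outside
  \<open>K\<close>.\<close>

lemma continuous_on_uniform_near_compact:
  fixes f :: "'a::metric_space \<Rightarrow> 'b::metric_space"
  assumes "compact K" "open U" "K \<subseteq> U" "continuous_on U f" "e > 0"
  obtains \<delta> where "\<delta> > 0" "\<And>\<xi> x. \<xi> \<in> K \<Longrightarrow> x \<in> ball \<xi> \<delta> \<Longrightarrow> x \<in> U \<and> dist (f x) (f \<xi>) < e"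
proof -
  define \<G> where "\<G> = {G. open G \<and> G \<subseteq> U \<and> (\<forall>x\<in>G. \<forall>y\<in>G. dist (f x) (f y) < e)}"
  have "K \<subseteq> \<Union>\<G>"
  proof
    fix \<xi> assume "\<xi> \<in> K"
    define G where "G = U \<inter> f -` ball (f \<xi>) (e / 2)"
    have "open G" unfolding G_def using assms by (intro continuous_open_preimage) auto
    moreover have "dist (f x) (f y) < e" if "x \<in> G" "y \<in> G" for x y
      by (rule dist_triangle_half_r[of "f \<xi>"]) (use that in \<open>auto simp: G_def\<close>)
    ultimately have "G \<in> \<G>" by (auto simp: \<G>_def G_def)
    moreover have "\<xi> \<in> G" using \<open>\<xi> \<in> K\<close> assms by (auto simp: G_def)
    ultimately show "\<xi> \<in> \<Union>\<G>" by blast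
  qed
  moreover have "\<And>G. G \<in> \<G> \<Longrightarrow> open G" by (simp add: \<G>_def)
  ultimately obtain \<delta> where \<delta>: "\<delta> > 0" "\<And>x. x \<in> K \<Longrightarrow> \<exists>G\<in>\<G>. ball x \<delta> \<subseteq> G"
    using Heine_Borel_lemma[OF assms(1)] by metis
  show ?thesis
  proof (rule that[OF \<delta>(1)])
    fix \<xi> x assume "\<xi> \<in> K" "x \<in> ball \<xi> \<delta>"
    moreover from \<delta>(2)[OF this(1)] obtain G where "G \<in> \<G>" "ball \<xi> \<delta> \<subseteq> G" by blast
    moreover have "\<xi> \<in> ball \<xi> \<delta>" using \<delta> by simp
    ultimately show "x \<in> U \<and> dist (f x) (f \<xi>) < e" unfolding \<G>_def by blast
  qed
qed

lemma mvt_along_segment: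
  fixes \<rho> :: "'a::real_normed_vector \<Rightarrow> real"
  assumes "\<And>\<tau>. 0 \<le> \<tau> \<Longrightarrow> \<tau> \<le> 1 \<Longrightarrow> (\<rho> has_derivative f' (p + \<tau> *\<^sub>R y)) (at (p + \<tau> *\<^sub>R y))"
  obtains \<tau> where "0 < \<tau>" "\<tau> < 1" "\<rho> (p + y) = \<rho> p + f' (p + \<tau> *\<^sub>R y) y"
proof -
  have "((\<lambda>t. \<rho> (p + t *\<^sub>R y)) has_derivative (\<lambda>t. f' (p + \<tau> *\<^sub>R y) (t *\<^sub>R y))) (at \<tau> within {0..1})"
    if "0 \<le> \<tau>" "\<tau> \<le> 1" for \<tau>
    by (rule has_derivative_compose[of "\<lambda>t. p + t *\<^sub>R y" "\<lambda>t. t *\<^sub>R y" \<tau> _ \<rho>])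
       (use assms[OF that] in \<open>auto intro!: derivative_eq_intros\<close>)
  then have "\<exists>\<tau>\<in>{0<..<1}. \<rho> (p + 1 *\<^sub>R y) - \<rho> (p + 0 *\<^sub>R y) = f' (p + \<tau> *\<^sub>R y) ((1 - 0) *\<^sub>R y)"
    by (intro mvt_simple[of 0 1 "\<lambda>t. \<rho> (p + t *\<^sub>R y)" "\<lambda>\<tau> t. f' (p + \<tau> *\<^sub>R y) (t *\<^sub>R y)"]) auto
  then show ?thesis using that by (auto simp: algebra_simps)
qed

text \<open>The derivative stays within \<open>c / 4\<close> of its value at \<open>\<xi>\<close>,
  so the mean value theorem decides the sign. The first claim treats a cone around the normal. The
  second moves along a tangential \<open>v\<close>, which raises \<open>\<rho>\<close> by at most
  \<open>\<bar>t\<bar> * M\<close>, and then inward, which lowers it by at least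
  \<open>c / 2 * s\<close>.\<close>

lemma negative_near_boundary:
  fixes f' :: "'a::euclidean_space \<Rightarrow> 'a \<Rightarrow>\<^sub>L real"
  assumes der: "\<And>x. x \<in> ball \<xi> \<delta> \<Longrightarrow> (\<rho> has_derivative blinfun_apply (f' x)) (at x)"
    and close: "\<And>x. x \<in> ball \<xi> \<delta> \<Longrightarrow> dist (f' x) (f' \<xi>) < c / 4"
    and norm: "\<And>v. f' \<xi> v = - g * (\<eta> \<bullet> v)" and "c \<le> g" "c > 0" "\<rho> \<xi> = 0" "norm \<eta> = 1"
  shows "0 < s \<Longrightarrow> norm u < s / 2 \<Longrightarrow> 3 / 2 * s \<le> \<delta> \<Longrightarrow> \<rho> (\<xi> + s *\<^sub>R \<eta> + u) < 0"
    and "0 \<le> s \<Longrightarrow> \<bar>t\<bar> + s < \<delta> \<Longrightarrow> norm v = 1 \<Longrightarrow> \<eta> \<bullet> v = 0 \<Longrightarrow>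
      (\<And>x. norm (x - \<xi>) \<le> \<bar>t\<bar> \<Longrightarrow> \<bar>f' x v - f' \<xi> v\<bar> \<le> M) \<Longrightarrow>
      \<bar>t\<bar> * M < c / 2 * s \<Longrightarrow> \<rho> (\<xi> + t *\<^sub>R v + s *\<^sub>R \<eta>) < 0"
proof -
  have close': "\<bar>f' x y - f' \<xi> y\<bar> \<le> c / 4 * norm y" if "x \<in> ball \<xi> \<delta>" for x y
  proof -
    have "\<bar>f' x y - f' \<xi> y\<bar> = norm ((f' x - f' \<xi>) y)" by (simp add: blinfun.diff_left)
    also have "\<dots> \<le> norm (f' x - f' \<xi>) * norm y" by (rule norm_blinfun)
    also have "\<dots> \<le> c / 4 * norm y" using close[OF that] by (intro mult_right_mono) (auto simp: dist_norm)
    finally show ?thesis .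
  qed
  have \<eta>1: "\<eta> \<bullet> \<eta> = 1" using assms by (simp add: norm_eq_1)
  {
    assume s: "0 < s" "norm u < s / 2" "3 / 2 * s \<le> \<delta>"
    define y where "y = s *\<^sub>R \<eta> + u"
    have y: "norm y < 3 / 2 * s"
      unfolding y_def using norm_triangle_ineq[of "s *\<^sub>R \<eta>" u] s assms by simp
    have inb: "\<xi> + \<tau> *\<^sub>R y \<in> ball \<xi> \<delta>" if "0 \<le> \<tau>" "\<tau> \<le> 1" for \<tau>
    proof -
      have "\<tau> * norm y \<le> 1 * norm y" using that by (intro mult_right_mono) auto
      then show ?thesis using y s that by (simp add: dist_norm)
    qed
    obtain \<tau> where \<tau>: "0 < \<tau>" "\<tau> < 1" "\<rho> (\<xi> + y) = \<rho> \<xi> + f' (\<xi> + \<tau> *\<^sub>R y) y"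
      using mvt_along_segment[of \<rho> f' \<xi> y, OF der[OF inb]] by metis
    have "\<bar>\<eta> \<bullet> u\<bar> \<le> s / 2" using Cauchy_Schwarz_ineq2[of \<eta> u] assms s by simp
    then have "s / 2 \<le> \<eta> \<bullet> y" by (simp add: y_def inner_add_right \<eta>1)
    \<comment> \<open>The main term is at most \<open>- (c * s / 2)\<close>, while the error stays
      below \<open>3 / 8 * c * s\<close>.\<close>
    then have "c * (s / 2) \<le> g * (\<eta> \<bullet> y)" using assms s by (intro mult_mono) auto
    moreover have "c / 4 * norm y < c / 4 * (3 / 2 * s)" using y \<open>c > 0\<close> by simp
    moreover have "f' (\<xi> + \<tau> *\<^sub>R y) y \<le> - (g * (\<eta> \<bullet> y)) + c / 4 * norm y"
      using abs_le_D1[OF close'[OF inb, of \<tau> y]] \<tau> norm[of y] by simp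
    moreover have "c * s > 0" using s assms by simp
    ultimately have "\<rho> (\<xi> + y) < 0" using \<tau> \<open>\<rho> \<xi> = 0\<close> by simp
    then show "\<rho> (\<xi> + s *\<^sub>R \<eta> + u) < 0" by (simp add: y_def add.assoc)
  }
  assume s: "0 \<le> s" "\<bar>t\<bar> + s < \<delta>" "norm v = 1" "\<eta> \<bullet> v = 0" and M: "\<bar>t\<bar> * M < c / 2 * s"
    "\<And>x. norm (x - \<xi>) \<le> \<bar>t\<bar> \<Longrightarrow> \<bar>f' x v - f' \<xi> v\<bar> \<le> M"
  have inb: "\<xi> + t *\<^sub>R v + \<tau> *\<^sub>R s *\<^sub>R \<eta> \<in> ball \<xi> \<delta>" if "0 \<le> \<tau>" "\<tau> \<le> 1" for \<tau>
  proof -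
    have "\<tau> * s \<le> 1 * s" using that s by (intro mult_right_mono) auto
    moreover have "norm (t *\<^sub>R v + (\<tau> * s) *\<^sub>R \<eta>) \<le> \<bar>t\<bar> + \<tau> * s"
      using norm_triangle_ineq[of "t *\<^sub>R v" "(\<tau> * s) *\<^sub>R \<eta>"] \<open>0 \<le> s\<close> that \<open>norm v = 1\<close> \<open>norm \<eta> = 1\<close> by simp
    ultimately have "norm (t *\<^sub>R v + (\<tau> * s) *\<^sub>R \<eta>) < \<delta>" using s(2) by linarith
    then have "dist (\<xi> + (t *\<^sub>R v + (\<tau> * s) *\<^sub>R \<eta>)) \<xi> < \<delta>" by (simp add: dist_norm)
    then show ?thesis by (simp add: dist_commute add.assoc)
  qed
  have inb0: "\<xi> + \<tau> *\<^sub>R t *\<^sub>R v \<in> ball \<xi> \<delta>" and le0: "\<bar>\<tau> * t\<bar> \<le> \<bar>t\<bar>" if "0 \<le> \<tau>" "\<tau> \<le> 1" for \<tau>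
  proof -
    have "\<tau> * \<bar>t\<bar> \<le> 1 * \<bar>t\<bar>" using that by (intro mult_right_mono) auto
    then show "\<bar>\<tau> * t\<bar> \<le> \<bar>t\<bar>" using that by (simp add: abs_mult)
    then show "\<xi> + \<tau> *\<^sub>R t *\<^sub>R v \<in> ball \<xi> \<delta>" using s by (simp add: dist_norm)
  qed
  obtain \<tau> where \<tau>: "0 < \<tau>" "\<tau> < 1" "\<rho> (\<xi> + t *\<^sub>R v) = \<rho> \<xi> + f' (\<xi> + \<tau> *\<^sub>R t *\<^sub>R v) (t *\<^sub>R v)"
    using mvt_along_segment[of \<rho> f' \<xi> "t *\<^sub>R v", OF der[OF inb0]] by metis
  have "\<bar>f' (\<xi> + \<tau> *\<^sub>R t *\<^sub>R v) v - f' \<xi> v\<bar> \<le> M" using \<tau> s le0[of \<tau>] by (intro M) simp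
  \<comment> \<open>Orthogonality to \<open>\<eta>\<close> makes \<open>f' \<xi> v\<close> vanish,
    so the oscillation bound \<open>M\<close> bounds the derivative itself.\<close>
  then have "\<bar>f' (\<xi> + \<tau> *\<^sub>R t *\<^sub>R v) v\<bar> \<le> M" using norm s by simp
  then have "\<bar>t\<bar> * \<bar>f' (\<xi> + \<tau> *\<^sub>R t *\<^sub>R v) v\<bar> \<le> \<bar>t\<bar> * M" by (intro mult_left_mono) auto
  then have 1: "\<rho> (\<xi> + t *\<^sub>R v) \<le> \<bar>t\<bar> * M"
    using \<tau>(3) \<open>\<rho> \<xi> = 0\<close> abs_ge_self[of "t * f' (\<xi> + \<tau> *\<^sub>R t *\<^sub>R v) v"]
    by (simp add: blinfun.scaleR_right abs_mult)
  obtain \<sigma> where \<sigma>: "0 < \<sigma>" "\<sigma> < 1"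
    "\<rho> (\<xi> + t *\<^sub>R v + s *\<^sub>R \<eta>) = \<rho> (\<xi> + t *\<^sub>R v) + f' (\<xi> + t *\<^sub>R v + \<sigma> *\<^sub>R s *\<^sub>R \<eta>) (s *\<^sub>R \<eta>)"
    using mvt_along_segment[of \<rho> f' "\<xi> + t *\<^sub>R v" "s *\<^sub>R \<eta>", OF der[OF inb]] by metis
  define k where "k = f' (\<xi> + t *\<^sub>R v + \<sigma> *\<^sub>R s *\<^sub>R \<eta>) \<eta>"
  have "k - f' \<xi> \<eta> \<le> c / 4"
    unfolding k_def using abs_le_D1[OF close'[OF inb, of \<sigma> \<eta>]] \<sigma>(1,2) \<open>norm \<eta> = 1\<close> by simp
  moreover have "f' \<xi> \<eta> = - g" using norm[of \<eta>] \<eta>1 by simp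
  ultimately have "k \<le> - (c / 2)" using \<open>c \<le> g\<close> \<open>c > 0\<close> by linarith
  then have "s * k \<le> s * - (c / 2)"
    using \<open>0 \<le> s\<close> by (rule mult_left_mono)
  moreover have "\<rho> (\<xi> + t *\<^sub>R v + s *\<^sub>R \<eta>) = \<rho> (\<xi> + t *\<^sub>R v) + s * k"
    using \<sigma>(3) by (simp add: k_def blinfun.scaleR_right)
  moreover have "s * - (c / 2) = - (c / 2 * s)" by simp
  ultimately show "\<rho> (\<xi> + t *\<^sub>R v + s *\<^sub>R \<eta>) < 0"
    using 1 M(1) by linarith
qed

lemma nearest_boundary_point:
  fixes \<Omega> :: "'a::euclidean_space set"
  assumes "open \<Omega>" "bounded \<Omega>" "z \<in> \<Omega>"
  obtains \<xi> \<eta> where "\<xi> \<in> frontier \<Omega>" "norm \<eta> = 1" "z = \<xi> + infdist z (- \<Omega>) *\<^sub>R \<eta>"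
    "infdist z (- \<Omega>) > 0" "ball z (infdist z (- \<Omega>)) \<subseteq> \<Omega>" "inward_unit_normal \<Omega> \<xi> \<eta>"
proof -
  define d where "d = infdist z (- \<Omega>)"
  \<comment> \<open>The value of \<open>infdist\<close> to the empty set is 0 by default;
    boundedness rules this case out.\<close>
  have "\<Omega> \<noteq> UNIV" using assms(2) not_bounded_UNIV by metis
  then have ne: "- \<Omega> \<noteq> {}" by blast
  obtain \<xi> where \<xi>: "\<xi> \<in> - \<Omega>" "d = dist z \<xi>"
    using infdist_attains_inf[of "- \<Omega>" z] ne assms(1) unfolding d_def by auto
  have d: "d > 0" using \<xi> assms(3) by auto
  have sub: "ball z d \<subseteq> \<Omega>"
  proof
    fix x assume x: "x \<in> ball z d"
    show "x \<in> \<Omega>"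
    proof (rule ccontr)
      assume "x \<notin> \<Omega>"
      then have "d \<le> dist z x" unfolding d_def by (intro infdist_le) auto
      then show False using x by simp
    qed
  qed
  define \<eta> where "\<eta> = (z - \<xi>) /\<^sub>R d"
  have \<eta>: "norm \<eta> = 1" "z = \<xi> + d *\<^sub>R \<eta>" using d \<xi>(2) by (auto simp: \<eta>_def dist_norm)
  have "\<xi> \<in> closure (ball z d)" using d \<xi>(2) by simp
  then have "\<xi> \<in> frontier \<Omega>"
    using closure_mono[OF sub] \<xi>(1) assms(1) by (auto simp: frontier_def interior_open)
  then show ?thesis
    using that \<eta> d sub inward_unit_normal_nearest[OF assms(1) sub \<eta> d] unfolding d_def by blast
qed

section \<open>The disc along the inward normal\<close>

text \<open>The disc obtained by substituting \<open>\<tau> * (1 - \<zeta>)\<close> into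
  \<open>h\<close> is centred at the deep point and reaches the target at the parameter
  \<open>1 - y / \<tau>\<close>, where \<open>h\<close> takes the value \<open>d\<close> at
  \<open>y\<close>. As \<open>y \<ge> d / 2\<close>, the Poincare cost is at most half the logarithm
  of \<open>4 * \<tau> / d\<close>.\<close>

lemma kobayashi_dist_le_normal_disc:
  fixes \<Omega> :: "(complex ^ 'n) set"
  assumes \<Omega>: "convex \<Omega>" "m > 0" "ball z\<^sub>0 m \<subseteq> \<Omega>" "N \<ge> (1::nat)"
      "\<And>p. p \<in> \<Omega> \<Longrightarrow> norm (p - z\<^sub>0) / N \<le> m / 2"
    and h: "h holomorphic_on {w. Re w > 0 \<and> norm w < \<theta>}"
      "\<And>x. 0 < x \<Longrightarrow> x < \<theta> \<Longrightarrow> h (complex_of_real x) \<in> \<real>"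
      "\<And>x. 0 < x \<Longrightarrow> x < \<theta> \<Longrightarrow> x \<le> Re (h (of_real x)) \<and> Re (h (of_real x)) \<le> 2 * x"
    and disc: "\<And>w. Re w > 0 \<Longrightarrow> norm w < 2 * \<tau> \<Longrightarrow> \<xi> + h w *s \<eta> \<in> \<Omega>"
    and deep: "ball (\<xi> + h (of_real \<tau>) *s \<eta>) m \<subseteq> \<Omega>"
    and d: "0 < d" "d < \<tau>" "2 * \<tau> \<le> \<theta>"
  shows "kobayashi_dist \<Omega> z\<^sub>0 (\<xi> + d *\<^sub>R \<eta>) \<le>
    N * poincare_dist 0 (1/2) + 1 / 2 * ln (4 * \<tau>) + 1 / 2 * ln (1 / d)"
proof -
  \<comment> \<open>Instead of inverting \<open>h\<close>, the intermediate value theorem is used: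
    \<open>h\<close> is at most \<open>d\<close> at \<open>d / 2\<close> and at least
    \<open>\<tau> > d\<close> at \<open>\<tau>\<close>.\<close>
  have "continuous_on {d/2..\<tau>} (\<lambda>y. Re (h (of_real y)))"
    by (rule continuous_on_compose2[OF continuous_on_Re[OF holomorphic_on_imp_continuous_on[OF h(1)]]])
       (use d in \<open>auto intro!: continuous_intros\<close>)
  moreover have "Re (h (of_real (d / 2))) \<le> d" "d \<le> Re (h (of_real \<tau>))"
    using h(3)[of "d / 2"] h(3)[of \<tau>] d by auto
  ultimately obtain y where y: "d / 2 \<le> y" "y \<le> \<tau>" "Re (h (of_real y)) = d"
    using IVT'[of "\<lambda>y. Re (h (of_real y))" "d / 2" d \<tau>] d by auto
  have hy: "h (of_real y) = of_real d"
    using h(2)[of y] y d by (auto simp: complex_eq_iff complex_is_Real_iff)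
  define x where "x = 1 - y / \<tau>"
  have x: "0 \<le> x" "x < 1" using y d by (auto simp: x_def)
  define f where "f \<zeta> = \<xi> + h (of_real \<tau> * (1 - \<zeta>)) *s \<eta>" for \<zeta>
  \<comment> \<open>The unit disc goes to the disc of centre and radius \<open>\<tau>\<close>, which
    touches 0 from the right half-plane.\<close>
  have inS: "Re (of_real \<tau> * (1 - \<zeta>)) > 0 \<and> norm (of_real \<tau> * (1 - \<zeta>)) < 2 * \<tau>"
    if "\<zeta> \<in> ball 0 1" for \<zeta>
  proof -
    have "norm (1 - \<zeta>) < 2" using that norm_triangle_ineq4[of 1 \<zeta>] by simp
    moreover have "Re \<zeta> < 1" using that complex_Re_le_cmod[of \<zeta>] by simp
    ultimately show ?thesis using d by (simp add: norm_mult)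
  qed
  have disc_f: "holomorphic_disc \<Omega> f"
    unfolding holomorphic_disc_def
  proof (intro conjI allI)
    have "(\<lambda>\<zeta>. h (of_real \<tau> * (1 - \<zeta>))) holomorphic_on ball 0 1"
      by (rule holomorphic_on_compose_gen[OF _ h(1), unfolded o_def])
         (use inS d in \<open>fastforce intro!: holomorphic_intros\<close>)+
    then show "(\<lambda>\<zeta>. f \<zeta> $ i) holomorphic_on ball 0 1" for i
      unfolding f_def by (auto intro!: holomorphic_intros)
    show "f ` ball 0 1 \<subseteq> \<Omega>" using disc inS by (auto simp: f_def)
  qed
  have f0: "f 0 = \<xi> + h (of_real \<tau>) *s \<eta>" by (simp add: f_def)
  have fx: "f (of_real x) = \<xi> + d *\<^sub>R \<eta>"
  proof -
    have "complex_of_real \<tau> * (1 - of_real x) = of_real (\<tau> * (1 - x))" by simp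
    also have "\<tau> * (1 - x) = y" using d by (simp add: x_def)
    finally have "f (of_real x) = \<xi> + complex_of_real d *s \<eta>" by (simp add: f_def hy)
    then show ?thesis by (simp add: of_real_vector_scalar_mult)
  qed
  have "\<xi> + h (of_real \<tau>) *s \<eta> \<in> ball (\<xi> + h (of_real \<tau>) *s \<eta>) m" using \<Omega>(2) by simp
  then have "\<xi> + h (of_real \<tau>) *s \<eta> \<in> \<Omega>" using deep by blast
  from \<Omega>(5)[OF this] have "kobayashi_dist \<Omega> z\<^sub>0 (\<xi> + d *\<^sub>R \<eta>) \<le>
      N * poincare_dist 0 (1/2) + poincare_dist 0 (of_real x)"
    using x by (intro kobayashi_dist_le_convex[OF \<Omega>(1-3) deep \<Omega>(4) _ disc_f _ _ f0 fx]) simp_all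
  also have "poincare_dist 0 (of_real x) \<le> 1 / 2 * ln (4 * \<tau> * (1 / d))"
  proof -
    have "(1 + x) / (1 - x) \<le> 2 / (1 - x)" using x by (intro divide_right_mono) auto
    also have "\<dots> = 2 * \<tau> / y" using d y by (simp add: x_def)
    also have "\<dots> \<le> 2 * \<tau> / (d / 2)" using d y by (intro divide_left_mono) auto
    finally have "(1 + x) / (1 - x) \<le> 4 * \<tau> * (1 / d)" by simp
    moreover have "(1 + x) / (1 - x) > 0" using x by simp
    ultimately have "ln ((1 + x) / (1 - x)) \<le> ln (4 * \<tau> * (1 / d))" by (rule ln_mono)
    then show ?thesis unfolding poincare_dist_0_of_real[OF x] by linarith
  qed
  also have "ln (4 * \<tau> * (1 / d)) = ln (4 * \<tau>) + ln (1 / d)" using d by (intro ln_mult_pos) auto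
  finally show ?thesis by (simp add: algebra_simps)
qed

section \<open>Uniform constants and the final estimate\<close>

theorem proposition4p6:
  fixes \<Omega> U :: "(complex ^ 'n) set" and \<rho> :: "complex ^ 'n \<Rightarrow> real"
    and r :: real and \<omega> :: "real \<Rightarrow> real" and z\<^sub>0 :: "complex ^ 'n"
  assumes "open \<Omega>" and "connected \<Omega>" and "bounded \<Omega>" and "convex \<Omega>" and "C1_boundary \<Omega>"
    and "r > 0" and "dini_condition (2 * r) \<omega>"
    and "defining_function \<Omega> U \<rho>"
    and "\<And>\<xi>. \<xi> \<in> frontier \<Omega> \<Longrightarrow> ball \<xi> r \<subseteq> U"
    and "\<And>\<xi> \<eta>. \<xi> \<in> frontier \<Omega> \<Longrightarrow> inward_unit_normal \<Omega> \<xi> \<eta> \<Longrightarrow>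
           has_modulus_of_continuity_on_ball \<xi> r (directional_derivative (\<i> *s \<eta>) \<rho>) \<omega>"
    and "z\<^sub>0 \<in> \<Omega>"
  shows "\<exists>C>0. \<forall>z\<in>\<Omega>. kobayashi_dist \<Omega> z\<^sub>0 z \<le> C + 1 / 2 * ln (1 / infdist z (- \<Omega>))"
proof -
  \<comment> \<open>Monotonicity of \<open>\<omega>\<close> is part of the hypothesis at boundary
    points, so one boundary point with an inward normal is exhibited first.\<close>
  obtain \<xi>\<^sub>0 \<eta>\<^sub>0 where \<xi>\<^sub>0: "\<xi>\<^sub>0 \<in> frontier \<Omega>" "inward_unit_normal \<Omega> \<xi>\<^sub>0 \<eta>\<^sub>0"
    and d\<^sub>0: "infdist z\<^sub>0 (- \<Omega>) > 0" "ball z\<^sub>0 (infdist z\<^sub>0 (- \<Omega>)) \<subseteq> \<Omega>"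
    using nearest_boundary_point[OF assms(1,3,11)] by metis
  have mono: "mono_on {0..<2*r} \<omega>" and nn: "\<And>t. t \<in> {0..<2*r} \<Longrightarrow> 0 \<le> \<omega> t"
    using assms(10)[OF \<xi>\<^sub>0] by (auto simp: has_modulus_of_continuity_on_ball_def)

  obtain f' :: "complex ^ 'n \<Rightarrow> (complex ^ 'n) \<Rightarrow>\<^sub>L real" where U: "open U" "frontier \<Omega> \<subseteq> U"
    and der: "\<And>x. x \<in> U \<Longrightarrow> (\<rho> has_derivative blinfun_apply (f' x)) (at x)"
    and cont: "continuous_on U f'" and neg: "\<Omega> \<inter> U = {x \<in> U. \<rho> x < 0}"
    and zero: "frontier \<Omega> = {x \<in> U. \<rho> x = 0}"
    and nz: "\<And>x. x \<in> frontier \<Omega> \<Longrightarrow> frechet_derivative \<rho> (at x) \<noteq> (\<lambda>v. 0)"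
    using assms(8) unfolding defining_function_def C1_on_def by blast
  have compact: "compact (frontier \<Omega>)" using assms(3) by (rule compact_frontier_bounded)
  \<comment> \<open>The minimum of the derivative norm over the compact boundary is attained, hence
    positive, and bounds the derivative below at all boundary points at once.\<close>
  obtain \<xi>\<^sub>1 where \<xi>\<^sub>1: "\<xi>\<^sub>1 \<in> frontier \<Omega>" "\<And>x. x \<in> frontier \<Omega> \<Longrightarrow> norm (f' \<xi>\<^sub>1) \<le> norm (f' x)"
    using continuous_attains_inf[OF compact, of "\<lambda>x. norm (f' x)"] \<xi>\<^sub>0(1)
      continuous_on_norm[OF continuous_on_subset[OF cont U(2)]] by blast
  define c where "c = norm (f' \<xi>\<^sub>1)"
  have c: "c > 0"
  proof -
    have "frechet_derivative \<rho> (at \<xi>\<^sub>1) = blinfun_apply (f' \<xi>\<^sub>1)"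
      using frechet_derivative_at[OF der] \<xi>\<^sub>1(1) U(2) by fastforce
    then have "f' \<xi>\<^sub>1 \<noteq> 0" using nz[OF \<xi>\<^sub>1(1)] by (metis zero_blinfun.rep_eq)
    then show ?thesis by (simp add: c_def)
  qed
  have c4': "c / 4 > 0" using c by simp
  obtain \<delta>\<^sub>0 where \<delta>\<^sub>0: "\<delta>\<^sub>0 > 0"
    "\<And>\<xi> x. \<xi> \<in> frontier \<Omega> \<Longrightarrow> x \<in> ball \<xi> \<delta>\<^sub>0 \<Longrightarrow> x \<in> U \<and> dist (f' x) (f' \<xi>) < c / 4"
    using continuous_on_uniform_near_compact[OF compact U cont c4'] by metis
  define \<delta> where "\<delta> = min \<delta>\<^sub>0 r"
  have \<delta>: "\<delta> > 0" "\<delta> \<le> r" using \<delta>\<^sub>0 assms(6) by (auto simp: \<delta>_def)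
  have \<delta>U: "x \<in> U" "dist (f' x) (f' \<xi>) < c / 4" if "\<xi> \<in> frontier \<Omega>" "x \<in> ball \<xi> \<delta>" for \<xi> x
    using \<delta>\<^sub>0(2)[OF that(1), of x] that(2) by (auto simp: \<delta>_def)

  \<comment> \<open>With the constant \<open>4 / c\<close> in the construction of \<open>h\<close>,
    the tangential gain \<open>2 * norm w * \<omega> (2 * norm w)\<close> is exactly
    \<open>c / 2\<close> times the guaranteed surplus of \<open>Re (h w)\<close> over
    \<open>Re w\<close>.\<close>
  have c4: "4 / c > 0" using c by simp
  obtain \<theta> h where \<theta>: "0 < \<theta>" "\<theta> < r" and hol: "h holomorphic_on {w. Re w > 0 \<and> norm w < \<theta>}"
    and h_le: "\<And>w. Re w > 0 \<Longrightarrow> norm w < \<theta> \<Longrightarrow> norm (h w) \<le> 2 * norm w"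
    and h_ge: "\<And>w. Re w > 0 \<Longrightarrow> norm w < \<theta> \<Longrightarrow> Re w + 4 / c * norm w * \<omega> (2 * norm w) \<le> Re (h w)"
    and h_real: "\<And>x. 0 < x \<Longrightarrow> x < \<theta> \<Longrightarrow> h (of_real x) \<in> \<real>"
    using holomorphic_map_above_modulus[OF assms(6) c4 ballI[OF nn] mono dini_summable[OF assms(7) mono]]
    by blast
  \<comment> \<open>The first bound keeps the half-disc of radius \<open>2 * \<tau>\<close> in the
    domain of \<open>h\<close>. By the second, real and imaginary part of \<open>h w\<close> are
    each below \<open>4 * \<tau> \<le> \<delta> / 4\<close>, so the points considered stay in
    \<open>ball \<xi> \<delta>\<close>.\<close>
  define \<tau> where "\<tau> = min (\<theta> / 4) (\<delta> / 16)"
  have \<tau>: "0 < \<tau>" "\<tau> \<le> \<theta> / 4" "\<tau> \<le> \<delta> / 16" using \<theta> \<delta> by (auto simp: \<tau>_def)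
  have h_bounds: "x \<le> Re (h (of_real x)) \<and> Re (h (of_real x)) \<le> 2 * x" if "0 < x" "x < \<theta>" for x
  proof -
    have "0 \<le> 4 / c * x * \<omega> (2 * x)" using that c \<theta> by (intro mult_nonneg_nonneg nn) auto
    then show ?thesis
      using h_ge[of "of_real x"] h_le[of "of_real x"] complex_Re_le_cmod[of "h (of_real x)"] that by auto
  qed
  define s where "s = Re (h (of_real \<tau>))"
  have s: "\<tau> \<le> s" "s \<le> 2 * \<tau>" using h_bounds[of \<tau>] \<tau> \<theta> by (auto simp: s_def)
  have hs: "h (of_real \<tau>) = of_real s"
    using h_real[of \<tau>] \<tau> \<theta> by (simp add: s_def complex_eq_iff complex_is_Real_iff)

  \<comment> \<open>The constants \<open>c\<close>, \<open>\<delta>\<close>, \<open>\<tau>\<close>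
    and the map \<open>h\<close> do not depend on \<open>\<xi>\<close>, so both inclusions hold at
    the same scale for every nearest point.\<close>
  have geom: "\<xi> + h w *s \<eta> \<in> \<Omega>" "ball (\<xi> + h (of_real \<tau>) *s \<eta>) (\<tau> / 2) \<subseteq> \<Omega>"
    if \<xi>: "\<xi> \<in> frontier \<Omega>" "norm \<eta> = 1" "z = \<xi> + d *\<^sub>R \<eta>" "d > 0" "ball z d \<subseteq> \<Omega>"
      "inward_unit_normal \<Omega> \<xi> \<eta>" and w: "Re w > 0" "norm w < 2 * \<tau>" for \<xi> \<eta> z d w
  proof -
    have \<xi>U: "\<xi> \<in> U" "\<rho> \<xi> = 0" using \<xi>(1) zero by auto
    have "\<rho> x \<le> 0" if "x \<in> U" "dist z x < d" for x
    proof -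
      have "x \<in> \<Omega> \<inter> U" using that \<xi>(5) by auto
      then show ?thesis using neg by auto
    qed
    note L = derivative_at_interior_ball[OF der[OF \<xi>U(1)] U(1) \<xi>U this \<xi>(2,3,4)]
    define g where "g = - f' \<xi> \<eta>"
    have norm_eq: "f' \<xi> v = - g * (\<eta> \<bullet> v)" for v using L(1)[of v] by (simp add: g_def)
    \<comment> \<open>By Cauchy-Schwarz the lower bound on the derivative norm becomes a lower bound
      for the slope \<open>g\<close> along the normal.\<close>
    have "norm (f' \<xi>) \<le> g"
    proof (rule norm_blinfun_bound)
      show "g \<ge> 0" using L(2) by (simp add: g_def)
      then show "norm (f' \<xi> v) \<le> g * norm v" for v
        using mult_left_mono[OF Cauchy_Schwarz_ineq2[of \<eta> v], of g] \<xi>(2) by (simp add: norm_eq abs_mult)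
    qed
    then have g: "c \<le> g" using \<xi>\<^sub>1(2)[OF \<xi>(1)] by (simp add: c_def)
    have ball\<delta>: "(\<rho> has_derivative blinfun_apply (f' x)) (at x)" "dist (f' x) (f' \<xi>) < c / 4"
      if "x \<in> ball \<xi> \<delta>" for x using \<delta>U[OF \<xi>(1) that] der by auto
    note near = negative_near_boundary[where f' = f' and \<rho> = \<rho> and \<xi> = \<xi> and \<eta> = \<eta>,
        OF ball\<delta> norm_eq g c \<xi>U(2) \<xi>(2)]
    have in\<Omega>: "x \<in> \<Omega>" if "\<rho> x < 0" "x \<in> ball \<xi> \<delta>" for x
      using \<delta>U(1)[OF \<xi>(1) that(2)] that(1) neg by auto

    show "ball (\<xi> + h (of_real \<tau>) *s \<eta>) (\<tau> / 2) \<subseteq> \<Omega>"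
    proof
      fix x assume x: "x \<in> ball (\<xi> + h (of_real \<tau>) *s \<eta>) (\<tau> / 2)"
      define u where "u = x - (\<xi> + s *\<^sub>R \<eta>)"
      have "h (of_real \<tau>) *s \<eta> = s *\<^sub>R \<eta>" by (simp add: hs of_real_vector_scalar_mult)
      then have u: "norm u < \<tau> / 2" using x by (simp add: u_def dist_norm norm_minus_commute)
      have xe: "x = \<xi> + s *\<^sub>R \<eta> + u" by (simp add: u_def)
      \<comment> \<open>Since \<open>\<tau> \<le> s\<close>, a perturbation of norm below
        \<open>\<tau> / 2\<close> stays in the cone \<open>norm u < s / 2\<close>.\<close>
      have "\<rho> (\<xi> + s *\<^sub>R \<eta> + u) < 0" using s u \<tau> by (intro near(1)) auto
      moreover have "norm (s *\<^sub>R \<eta> + u) < \<delta>"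
        using norm_triangle_ineq[of "s *\<^sub>R \<eta>" u] s u \<tau> \<xi>(2) by simp
      then have "dist (\<xi> + (s *\<^sub>R \<eta> + u)) \<xi> < \<delta>" by (simp add: dist_norm)
      then have "x \<in> ball \<xi> \<delta>" by (simp add: xe dist_commute add.assoc)
      ultimately show "x \<in> \<Omega>" using in\<Omega> xe by blast
    qed

    \<comment> \<open>Multiplying \<open>\<eta>\<close> by \<open>h w\<close> displaces by
      \<open>a\<close> along the normal and by \<open>t\<close> along the tangent vector
      \<open>v\<close>, the direction in which the modulus of continuity is given.\<close>
    define v where "v = \<i> *s \<eta>"
    define t where "t = Im (h w)"
    define a where "a = Re (h w)"
    have w\<theta>: "norm w < \<theta>" using w \<tau> \<theta> by simp
    have pt: "\<xi> + h w *s \<eta> = \<xi> + t *\<^sub>R v + a *\<^sub>R \<eta>"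

      unfolding v_def t_def a_def by (subst vector_scalar_mult_complex) simp
    have v: "norm v = 1" "\<eta> \<bullet> v = 0"
      by (simp_all add: v_def norm_vector_scalar_mult inner_i_vector_scalar_mult \<xi>(2))
    have hw: "norm (h w) \<le> 2 * norm w" using h_le w w\<theta> by blast
    have a: "Re w + 4 / c * norm w * \<omega> (2 * norm w) \<le> a" using h_ge w w\<theta> by (simp add: a_def)
    have \<omega>0: "0 \<le> \<omega> (2 * norm w)" using w\<theta> \<theta> by (intro nn) auto
    have a0: "0 \<le> a"
    proof -
      have "0 \<le> 4 / c * norm w * \<omega> (2 * norm w)" using \<omega>0 c by simp
      then show ?thesis using a w by linarith
    qed
    have t: "\<bar>t\<bar> \<le> 2 * norm w" using hw abs_Im_le_cmod[of "h w"] by (simp add: t_def)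
    have "a \<le> 2 * norm w" using hw complex_Re_le_cmod[of "h w"] by (simp add: a_def)
    with t have ta: "\<bar>t\<bar> + a < \<delta>" using w(2) \<tau>(3) \<delta>(1) by linarith
    have modulus: "\<bar>f' x v - f' \<xi> v\<bar> \<le> \<omega> (2 * norm w)" if x: "norm (x - \<xi>) \<le> \<bar>t\<bar>" for x
    proof -
      have dd: "directional_derivative v \<rho> y = f' y v" if "y \<in> U" for y
      proof -
        have "((\<lambda>t. \<rho> (y + t *\<^sub>R v)) has_derivative (\<lambda>t. f' y (t *\<^sub>R v))) (at 0)"
          by (rule has_derivative_compose[of "\<lambda>t. y + t *\<^sub>R v" "\<lambda>t. t *\<^sub>R v" 0 UNIV \<rho>])
             (use der[OF that] in \<open>auto intro!: derivative_eq_intros\<close>)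
        then have "((\<lambda>t. \<rho> (y + t *\<^sub>R v)) has_real_derivative f' y v) (at 0)"
          by (simp add: has_field_derivative_def blinfun.scaleR_right mult_commute_abs)
        then show ?thesis unfolding directional_derivative_def by (rule DERIV_imp_deriv)
      qed
      have x\<delta>: "x \<in> ball \<xi> \<delta>" using x ta a0 by (simp add: dist_norm norm_minus_commute)
      then have "x \<in> ball \<xi> r" "\<xi> \<in> ball \<xi> r" using \<delta> by auto
      then have "\<bar>directional_derivative v \<rho> x - directional_derivative v \<rho> \<xi>\<bar> \<le> \<omega> (norm (x - \<xi>))"
        using assms(10)[OF \<xi>(1,6)] unfolding has_modulus_of_continuity_on_ball_def v_def by blast
      also have "\<dots> \<le> \<omega> (2 * norm w)"
        using x t w\<theta> \<theta> by (intro mono_onD[OF mono]) auto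
      finally show ?thesis using dd[OF \<delta>U(1)[OF \<xi>(1) x\<delta>]] dd[OF \<xi>U(1)] by simp
    qed
    have "\<bar>t\<bar> * \<omega> (2 * norm w) < c / 2 * a"
    proof -
      have "\<bar>t\<bar> * \<omega> (2 * norm w) \<le> 2 * norm w * \<omega> (2 * norm w)"
        using t \<omega>0 by (rule mult_right_mono)
      also have "\<dots> = c / 2 * (4 / c * norm w * \<omega> (2 * norm w))" using c by simp
      \<comment> \<open>Strictness comes from the summand \<open>Re w > 0\<close>.\<close>
      also have "\<dots> < c / 2 * a" using a w c by (intro mult_strict_left_mono) auto
      finally show ?thesis .
    qed
    with a0 ta v modulus have "\<rho> (\<xi> + t *\<^sub>R v + a *\<^sub>R \<eta>) < 0"
      by (rule near(2)[rotated 2])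
    moreover have "norm (t *\<^sub>R v + a *\<^sub>R \<eta>) < \<delta>"
      using norm_triangle_ineq[of "t *\<^sub>R v" "a *\<^sub>R \<eta>"] ta a0 v(1) \<xi>(2) by simp
    then have "dist (\<xi> + (t *\<^sub>R v + a *\<^sub>R \<eta>)) \<xi> < \<delta>" by (simp add: dist_norm)
    then have "\<xi> + t *\<^sub>R v + a *\<^sub>R \<eta> \<in> ball \<xi> \<delta>" by (simp add: dist_commute add.assoc)
    ultimately show "\<xi> + h w *s \<eta> \<in> \<Omega>" unfolding pt by (rule in\<Omega>)
  qed

  \<comment> \<open>One radius serves for both ends of every chain: for \<open>z\<^sub>0\<close>,
    and for the deep point or a point \<open>z\<close> at depth at least
    \<open>\<tau>\<close>.\<close>
  define m where "m = min (infdist z\<^sub>0 (- \<Omega>)) (\<tau> / 2)"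
  have m: "m > 0" "ball z\<^sub>0 m \<subseteq> \<Omega>" "m \<le> \<tau> / 2" using d\<^sub>0 \<tau> by (auto simp: m_def)
  obtain D where D: "D > 0" "\<And>x y. x \<in> closure \<Omega> \<Longrightarrow> y \<in> closure \<Omega> \<Longrightarrow> dist x y \<le> D"
  proof
    show "0 < diameter (closure \<Omega>) + 1" using diameter_ge_0[OF bounded_closure[OF assms(3)]] by simp
    show "dist x y \<le> diameter (closure \<Omega>) + 1" if "x \<in> closure \<Omega>" "y \<in> closure \<Omega>" for x y
      using diameter_bounded_bound[OF bounded_closure[OF assms(3)] that] by simp
  qed
  \<comment> \<open>A bound on all distances in the closure makes one number of steps suffice for
    every end point.\<close>
  obtain N :: nat where "2 * D / m < N" using reals_Archimedean2 by blast
  moreover define N' where "N' = Suc N"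
  ultimately have N: "N' \<ge> 1" "2 * D / m \<le> N'" by auto
  have step: "norm (p - z\<^sub>0) / N' \<le> m / 2" if "p \<in> \<Omega>" for p
  proof -
    have "norm (p - z\<^sub>0) \<le> D"
      using D(2)[of p z\<^sub>0] that assms(11) closure_subset[of \<Omega>] by (auto simp: dist_norm)
    also have "D \<le> N' * m / 2" using N(2) m(1) by (simp add: field_simps)
    finally show ?thesis using N(1) by (simp add: field_simps)
  qed
  define P where "P = N' * poincare_dist 0 (1/2)"
  have P: "P \<ge> 0" unfolding P_def by (intro mult_nonneg_nonneg poincare_dist_nonneg) auto
  \<comment> \<open>The summands pay for the chain, for the constant of the normal disc, and for
    \<open>ln (1 / d)\<close>, which may be negative at deep points but is at least
    \<open>- ln D\<close>; the 1 makes \<open>C\<close> positive.\<close>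
  define C where "C = P + \<bar>1 / 2 * ln (4 * \<tau>)\<bar> + \<bar>1 / 2 * ln D\<bar> + 1"
  have "kobayashi_dist \<Omega> z\<^sub>0 z \<le> C + 1 / 2 * ln (1 / infdist z (- \<Omega>))" if z: "z \<in> \<Omega>" for z
  proof -
    define d where "d = infdist z (- \<Omega>)"
    obtain \<xi> \<eta> where \<xi>: "\<xi> \<in> frontier \<Omega>" "norm \<eta> = 1" "z = \<xi> + d *\<^sub>R \<eta>" "d > 0" "ball z d \<subseteq> \<Omega>"
      "inward_unit_normal \<Omega> \<xi> \<eta>"
      using nearest_boundary_point[OF assms(1,3) z] unfolding d_def by metis
    show ?thesis
    proof (cases "d < \<tau>")
      case True
      have "kobayashi_dist \<Omega> z\<^sub>0 (\<xi> + d *\<^sub>R \<eta>) \<le> P + 1 / 2 * ln (4 * \<tau>) + 1 / 2 * ln (1 / d)"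
        unfolding P_def
      proof (rule kobayashi_dist_le_normal_disc[OF assms(4) m(1,2) N(1) step hol h_real h_bounds])
        show "\<xi> + h w *s \<eta> \<in> \<Omega>" if "Re w > 0" "norm w < 2 * \<tau>" for w
          using geom(1)[OF \<xi>] that .
        have "ball (\<xi> + h (of_real \<tau>) *s \<eta>) (\<tau> / 2) \<subseteq> \<Omega>"
          using geom(2)[OF \<xi>, of "of_real \<tau>"] \<tau> by simp
        then show "ball (\<xi> + h (of_real \<tau>) *s \<eta>) m \<subseteq> \<Omega>"
          using subset_ball[OF m(3)] by blast
      qed (use \<xi>(4) True \<tau> \<theta> in auto)
      then show ?thesis
        unfolding d_def[symmetric] \<xi>(3)[symmetric] C_def by linarith
    next
      case False
      then have "m \<le> d" using m \<tau> by simp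
      \<comment> \<open>At depth at least \<open>\<tau>\<close> the chain can end at
        \<open>z\<close> itself; a constant disc of cost 0 fills the last link.\<close>
      have disc: "holomorphic_disc \<Omega> (\<lambda>_. z)" using z by (auto simp: holomorphic_disc_def)
      have "kobayashi_dist \<Omega> z\<^sub>0 z \<le> N' * poincare_dist 0 (1/2) + poincare_dist 0 0"
        using subset_ball[OF \<open>m \<le> d\<close>] \<xi>(5)
        by (intro kobayashi_dist_le_convex[OF assms(4) m(1,2) _ N(1) step[OF z] disc]) auto
      then have "kobayashi_dist \<Omega> z\<^sub>0 z \<le> P" by (simp add: P_def poincare_dist_def)
      moreover have "d \<le> D"
      proof -
        have "d = dist z \<xi>" using \<xi> by (simp add: dist_norm)
        also have "\<dots> \<le> D" using z \<xi>(1) closure_subset[of \<Omega>] by (intro D) (auto simp: frontier_def)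
        finally show ?thesis .
      qed
      then have "ln d \<le> ln D" using \<xi>(4) by simp
      then have "ln (1 / d) \<ge> - ln D" using \<xi>(4) by (simp add: ln_div)
      ultimately show ?thesis unfolding d_def[symmetric] C_def by linarith
    qed
  qed
  moreover have "C > 0" using P by (simp add: C_def)
  ultimately show ?thesis by blast
qed

end
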